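(* Let $\mathcal{C}$ be a set of positive integers and let $\mathcal{P}$ be the class of graphs having no hole whose length belongs to $\mathcal{C}$. If $\mathcal{P}$ is expressible by forbidden acyclic orientations, then at least one of the following holds: (1) $\mathcal{C}$ is finite; (2) $\mathcal{C}$ is a cofinite subset of $\mathbb{Z}^+$ (equivalently, $cyc(\mathcal{P})$ is finite); (3) there is a positive integer $M$ such that $\mathcal{C}_M$ is the set of odd integers greater than or equal to $M$ (equivalently, $cyc(\mathcal{P})_M$ is the set of even integers greater than or equal to $M$).
   Context: Graphs are finite and simple; $C_k$ is the cycle with $k$ vertices. A hole is an induced cycle of length at least four. An oriented graph is a digraph without loops, parallel arcs or pairs of opposite arcs; an orientation assigns a direction to each edge; it is acyclic if it has no directed cycle. For a set $F$ of oriented graphs, an oriented graph is $F$-free if no member of $F$ is isomorphic to an induced subdigraph of it. A graph class $\mathcal{P}$ is expressible by forbidden acyclic orientations if there is a finite set $F$ of oriented graphs such that a graph belongs to $\mathcal{P}$ iff it admits an acyclic $F$-free orientation. $cyc(\mathcal{P})$ is the set of integers $k\ge3$ with $C_k\in\mathcal{P}$; for a set $B$ of integers, $B_M=\{b\in B:b\ge M\}$. *)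

theory Defs
  imports "Graph_Theory.Graph_Theory"
begin

text \<open>
  A finite simple graph is a \<^const>\<open>pair_graph\<close>: an edge \<open>uv\<close> is the pair of
  opposite arcs \<open>(u,v)\<close>, \<open>(v,u)\<close>. Every finite graph and every finite oriented graph has an
  isomorphic copy with vertices in \<open>nat\<close>, so graph classes are represented by sets of
  graphs on \<open>nat\<close>.
\<close>

definition cycle_graph :: "nat \<Rightarrow> nat pair_pre_digraph" where
  "cycle_graph k = \<lparr> pverts = {..<k},
     parcs = {(i, j). i < k \<and> j < k \<and> (j = Suc i mod k \<or> i = Suc j mod k)} \<rparr>"

lemma pair_graph_cycle_graph:
  assumes "3 \<le> k" shows "pair_graph (cycle_graph k)"
proof -
  have "finite (parcs (cycle_graph k))"
    by (rule finite_subset[of _ "{..<k} \<times> {..<k}"]) (auto simp: cycle_graph_def)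
  then show ?thesis
    using assms
    by unfold_locales (auto simp: cycle_graph_def symmetric_def sym_def mod_Suc split: if_splits)
qed

definition hole :: "nat pair_pre_digraph \<Rightarrow> nat pair_pre_digraph \<Rightarrow> nat \<Rightarrow> bool" where
  "hole G H k \<longleftrightarrow> 4 \<le> k \<and> induced_subgraph (with_proj H) (with_proj G) \<and>
     digraph_iso (with_proj H) (with_proj (cycle_graph k))"

definition no_hole_class :: "nat set \<Rightarrow> nat pair_pre_digraph set" where
  "no_hole_class C = {G. pair_graph G \<and> \<not> (\<exists>H. \<exists>k\<in>C. hole G H k)}"

definition oriented_graph :: "nat pair_pre_digraph \<Rightarrow> bool" where
  "oriented_graph D \<longleftrightarrow> pair_digraph D \<and> (\<forall>u v. (u, v) \<in> parcs D \<longrightarrow> (v, u) \<notin> parcs D)"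

definition orientation_of :: "nat pair_pre_digraph \<Rightarrow> nat pair_pre_digraph \<Rightarrow> bool" where
  "orientation_of D G \<longleftrightarrow> oriented_graph D \<and> mk_symmetric (with_proj D) = G"

definition acyclic_digraph :: "nat pair_pre_digraph \<Rightarrow> bool" where
  "acyclic_digraph D \<longleftrightarrow> \<not> (\<exists>p. pre_digraph.cycle (with_proj D) p)"

definition free_of :: "nat pair_pre_digraph set \<Rightarrow> nat pair_pre_digraph \<Rightarrow> bool" where
  "free_of F D \<longleftrightarrow> \<not> (\<exists>A\<in>F. \<exists>H. induced_subgraph (with_proj H) (with_proj D) \<and>
     digraph_iso (with_proj A) (with_proj H))"

definition expressible_by_forbidden_acyclic_orientations ::
    "nat pair_pre_digraph set \<Rightarrow> bool" where
  "expressible_by_forbidden_acyclic_orientations P \<longleftrightarrow>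
     (\<exists>F. finite F \<and> (\<forall>A\<in>F. oriented_graph A) \<and>
       (\<forall>G. pair_graph G \<longrightarrow>
         (G \<in> P \<longleftrightarrow> (\<exists>D. orientation_of D G \<and> acyclic_digraph D \<and> free_of F D))))"

definition cyc :: "nat pair_pre_digraph set \<Rightarrow> nat set" where
  "cyc P = {k. 3 \<le> k \<and> cycle_graph k \<in> P}"

definition at_least_part :: "nat set \<Rightarrow> nat \<Rightarrow> nat set" where
  "at_least_part B M = {b \<in> B. M \<le> b}"

end

theory Submission
  imports Defs
begin

text \<open>
  Let \<open>N\<close> bound the orders of the forbidden digraphs and let \<open>k \<ge> N + 2\<close> be a cycle length in the
  class. Take many disjoint spiders, each with many legs, where a leg is a path of length \<open>n\<close> ending
  at a vertex of a \<open>k\<close>-cycle. All holes have length \<open>k\<close>, so there is an acyclic \<open>F\<close>-free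
  orientation. By the pigeonhole principle many spiders contain two legs oriented alike, all by the
  same pattern. The closed walk that runs down a leg, \<open>m\<close> times around the cycle and back to the root
  reads off an orientation of the cycle of length \<open>2 n + m k\<close>. Each of its stretches of \<open>N\<close> vertices
  is an induced path of a spider (at the root, change to the twin leg), so this orientation is
  \<open>F\<close>-free; it is acyclic since the root becomes a source or a sink. Hence \<open>2 n + m k\<close> is a cycle
  length of the class for all \<open>n \<ge> N\<close>: with \<open>m = 1\<close> these are all large numbers of the parity of
  \<open>k\<close>, and with \<open>m = 2\<close> all large even numbers.
\<close>

subsection \<open>Induced embeddings and holes\<close>

text \<open>A common form for holes, where both digraphs are symmetric, and for forbidden oriented
  patterns. It removes the explicit copy \<open>H\<close> and the records of isomorphism
  maps.\<close>

definition embeds :: "nat pair_pre_digraph \<Rightarrow> nat pair_pre_digraph \<Rightarrow> bool" where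
  "embeds A D \<longleftrightarrow> (\<exists>f. inj_on f (pverts A) \<and> f ` pverts A \<subseteq> pverts D \<and>
     (\<forall>u\<in>pverts A. \<forall>v\<in>pverts A. (u, v) \<in> parcs A \<longleftrightarrow> (f u, f v) \<in> parcs D))"

lemma induced_subgraph_with_proj_iff:
  assumes "pair_wf_digraph G"
  shows "induced_subgraph (with_proj H) (with_proj G) \<longleftrightarrow>
    pverts H \<subseteq> pverts G \<and> parcs H = parcs G \<inter> (pverts H \<times> pverts H)"
proof -
  have "pair_wf_digraph H" if "parcs H = parcs G \<inter> (pverts H \<times> pverts H)"
  proof
    fix e assume "e \<in> parcs H"
    then have "e \<in> pverts H \<times> pverts H" unfolding that by blast
    then show "fst e \<in> pverts H" "snd e \<in> pverts H" by auto
  qed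
  then show ?thesis
    using assms unfolding induced_subgraph_def subgraph_def wf_digraph_wp_iff
    by (auto simp: compatible_def)
qed

text \<open>An arc of a pair digraph is the pair of its ends, so the vertex map \<open>f\<close>
  determines the rest of the isomorphism record: arcs move by \<open>map_prod f f\<close>, and tail
  and head remain \<open>fst\<close> and \<open>snd\<close>.\<close>

lemma digraph_iso_with_proj_iff:
  assumes "pair_wf_digraph A"
  shows "digraph_iso (with_proj A) (with_proj B) \<longleftrightarrow>
    (\<exists>f. inj_on f (pverts A) \<and> pverts B = f ` pverts A \<and> parcs B = map_prod f f ` parcs A)"
    (is "?L \<longleftrightarrow> ?R")
proof
  assume ?L
  then obtain h where iso: "pre_digraph.digraph_isomorphism (with_proj A) h"
    and B: "with_proj B = app_iso h (with_proj A)"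
    by (auto simp: digraph_iso_def)
  let ?f = "iso_verts h"
  have tl: "iso_tail h = fst" and hd: "iso_head h = snd"
    and v: "pverts B = ?f ` pverts A" and a: "parcs B = iso_arcs h ` parcs A"
    using arg_cong[OF B, of tail] arg_cong[OF B, of head] arg_cong[OF B, of verts]
      arg_cong[OF B, of arcs] by simp_all
  have "iso_arcs h e = map_prod ?f ?f e" if "e \<in> parcs A" for e
    using iso that unfolding pre_digraph.digraph_isomorphism_def tl hd
    by (simp add: prod_eq_iff)
  then have "parcs B = map_prod ?f ?f ` parcs A"
    unfolding a by (rule image_cong[OF refl])
  moreover have "inj_on ?f (pverts A)"
    using iso unfolding pre_digraph.digraph_isomorphism_def by simp
  ultimately show ?R using v by blast
next
  assume ?R
  then obtain f where f: "inj_on f (pverts A)" "pverts B = f ` pverts A"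
    "parcs B = map_prod f f ` parcs A" by blast
  interpret A: pair_wf_digraph A by fact
  have "parcs A \<subseteq> pverts A \<times> pverts A"
    by (auto dest: A.in_arcsD1 A.in_arcsD2)
  then have "inj_on (map_prod f f) (parcs A)"
    using map_prod_inj_on[OF f(1) f(1)] inj_on_subset by blast
  with f(1) assms have "pre_digraph.digraph_isomorphism (with_proj A)
      \<lparr>iso_verts = f, iso_arcs = map_prod f f, iso_head = snd, iso_tail = fst\<rparr>"
    by (simp add: pre_digraph.digraph_isomorphism_def wf_digraph_wp_iff)
  moreover have "with_proj B = app_iso
      \<lparr>iso_verts = f, iso_arcs = map_prod f f, iso_head = snd, iso_tail = fst\<rparr> (with_proj A)"
    using f by (simp add: app_iso_def with_proj_def)
  ultimately show ?L unfolding digraph_iso_def by blast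
qed

lemma ex_induced_iso_iff_embeds:
  assumes A: "pair_wf_digraph A" and D: "pair_wf_digraph D"
  shows "(\<exists>H. induced_subgraph (with_proj H) (with_proj D) \<and>
      digraph_iso (with_proj A) (with_proj H)) \<longleftrightarrow> embeds A D" (is "?L \<longleftrightarrow> ?R")
proof -
  have AA: "u \<in> pverts A" "v \<in> pverts A" if "(u, v) \<in> parcs A" for u v
    using that pair_wf_digraph.in_arcsD1[OF A] pair_wf_digraph.in_arcsD2[OF A] by auto
  show ?thesis
  proof
    assume ?L
    then obtain H where "induced_subgraph (with_proj H) (with_proj D)"
      and iso: "digraph_iso (with_proj A) (with_proj H)" by blast
    then have *: "pverts H \<subseteq> pverts D" "parcs H = parcs D \<inter> (pverts H \<times> pverts H)"
      by (simp_all add: induced_subgraph_with_proj_iff[OF D])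
    from iso obtain f where
      f: "inj_on f (pverts A)" "pverts H = f ` pverts A" "parcs H = map_prod f f ` parcs A"
      by (auto simp: digraph_iso_with_proj_iff[OF A])
    have "(u, v) \<in> parcs A \<longleftrightarrow> (f u, f v) \<in> parcs D"
      if uv: "u \<in> pverts A" "v \<in> pverts A" for u v
    proof
      assume "(u, v) \<in> parcs A"
      then have "(f u, f v) \<in> parcs H" unfolding f(3) by force
      then show "(f u, f v) \<in> parcs D" using *(2) by auto
    next
      assume "(f u, f v) \<in> parcs D"
      then have "(f u, f v) \<in> parcs H" using *(2) f(2) uv by auto
      then obtain u' v' where "(u', v') \<in> parcs A" "f u = f u'" "f v = f v'"
        unfolding f(3) by auto
      with AA[of u' v'] inj_onD[OF f(1)] uv show "(u, v) \<in> parcs A" by metis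
    qed
    then show ?R using *(1) f(1,2) unfolding embeds_def by blast
  next
    assume ?R
    then obtain f where f: "inj_on f (pverts A)" "f ` pverts A \<subseteq> pverts D"
      "\<And>u v. u \<in> pverts A \<Longrightarrow> v \<in> pverts A \<Longrightarrow> (u, v) \<in> parcs A \<longleftrightarrow> (f u, f v) \<in> parcs D"
      unfolding embeds_def by blast
    let ?H = "\<lparr>pverts = f ` pverts A, parcs = map_prod f f ` parcs A\<rparr>"
    have "parcs ?H = parcs D \<inter> (pverts ?H \<times> pverts ?H)"
    proof (intro equalityI subrelI)
      fix x y assume "(x, y) \<in> parcs ?H"
      then obtain u v where "(u, v) \<in> parcs A" "x = f u" "y = f v" by auto
      with AA[of u v] f(3) show "(x, y) \<in> parcs D \<inter> (pverts ?H \<times> pverts ?H)" by simp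
    next
      fix x y assume xy: "(x, y) \<in> parcs D \<inter> (pverts ?H \<times> pverts ?H)"
      then obtain u v where "u \<in> pverts A" "v \<in> pverts A" "x = f u" "y = f v" by auto
      with f(3)[of u v] xy show "(x, y) \<in> parcs ?H" by force
    qed
    with f(2) have "induced_subgraph (with_proj ?H) (with_proj D)"
      unfolding induced_subgraph_with_proj_iff[OF D] by simp
    moreover have "digraph_iso (with_proj A) (with_proj ?H)"
      unfolding digraph_iso_with_proj_iff[OF A] using f(1) by auto
    ultimately show ?L by blast
  qed
qed

lemma free_of_iff_embeds:
  assumes "\<forall>A\<in>F. oriented_graph A" "oriented_graph D"
  shows "free_of F D \<longleftrightarrow> (\<forall>A\<in>F. \<not> embeds A D)"
proof -
  have wf: "pair_wf_digraph A" if "oriented_graph A" for A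
    using that unfolding oriented_graph_def pair_digraph_def pair_fin_digraph_def by blast
  then show ?thesis
    using assms ex_induced_iso_iff_embeds unfolding free_of_def by blast
qed

text \<open>In \<open>hole\<close> the isomorphism goes from the subgraph to the cycle, while
  embeddings go the other way; symmetry of isomorphism bridges the two.\<close>

lemma ex_hole_iff_embeds:
  assumes "pair_graph G"
  shows "(\<exists>H. hole G H k) \<longleftrightarrow> 4 \<le> k \<and> embeds (cycle_graph k) G"
proof (cases "4 \<le> k")
  case True
  interpret G: pair_graph G by fact
  interpret C: pair_graph "cycle_graph k" using True by (intro pair_graph_cycle_graph) simp
  have "digraph_iso (with_proj H) (with_proj (cycle_graph k)) \<longleftrightarrow>
      digraph_iso (with_proj (cycle_graph k)) (with_proj H)"
    if "induced_subgraph (with_proj H) (with_proj G)" for H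
  proof -
    have "wf_digraph (with_proj H)" using that by (simp add: induced_subgraph_def subgraph_def)
    then show ?thesis
      using digraph_iso_swap[of "with_proj H" "with_proj (cycle_graph k)"]
        digraph_iso_swap[OF C.wf_digraph_axioms] by blast
  qed
  then show ?thesis
    using True ex_induced_iso_iff_embeds[OF C.pair_wf_digraph_axioms G.pair_wf_digraph_axioms]
    unfolding hole_def by blast
qed (auto simp: hole_def)

lemma mem_no_hole_class_iff:
  "G \<in> no_hole_class C \<longleftrightarrow> pair_graph G \<and> (\<forall>k\<in>C. 4 \<le> k \<longrightarrow> \<not> embeds (cycle_graph k) G)"
  using ex_hole_iff_embeds unfolding no_hole_class_def by blast

section \<open>Embedded cycles and their neighbourhoods\<close>

lemma closed_under_Suc_mod_imp_all:
  assumes "T \<subseteq> {..<c}" "T \<noteq> {}" and step: "\<And>t. t \<in> T \<Longrightarrow> Suc t mod c \<in> T"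
  shows "T = {..<c::nat}"
proof -
  obtain t where t: "t \<in> T" "t < c" using assms(1,2) by auto
  have iter: "(t + j) mod c \<in> T" for j
  proof (induction j)
    case (Suc j)
    from step[OF this] show ?case by (simp add: mod_Suc_eq)
  qed (use t in simp)
  \<comment> \<open>The extra summand \<open>c\<close> keeps the subtraction of \<open>t\<close>
    from truncating.\<close>
  have "x \<in> T" if "x < c" for x
    using iter[of "x + c - t"] t that by simp
  with assms(1) show ?thesis by auto
qed

lemma cycle_graph_neighbours:
  assumes "3 \<le> c" "t < c"
  obtains t' where "t' < c" "t' \<noteq> Suc t mod c"
    "\<And>u. (t, u) \<in> parcs (cycle_graph c) \<longleftrightarrow> u = Suc t mod c \<or> u = t'"
proof
  show "(if t = 0 then c - 1 else t - 1) < c" "(if t = 0 then c - 1 else t - 1) \<noteq> Suc t mod c"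
    using assms by (auto simp: mod_Suc)
  show "(t, u) \<in> parcs (cycle_graph c) \<longleftrightarrow>
      u = Suc t mod c \<or> u = (if t = 0 then c - 1 else t - 1)" for u
    using assms by (auto simp: cycle_graph_def mod_Suc split: if_splits)
qed

text \<open>This replaces tracing a cycle: its vertex set \<open>U\<close> has inner degree at least
  two and is minimal with that property. Minimality holds because each vertex has only two
  neighbours on the cycle, so a subset keeping two of them is closed under the successor.\<close>

lemma embedded_cycle_two_neighbours:
  assumes "embeds (cycle_graph c) G" "3 \<le> c"
  obtains U where "U \<subseteq> pverts G" "card U = c"
    "\<And>v. v \<in> U \<Longrightarrow> \<exists>y\<in>U. \<exists>z\<in>U. y \<noteq> z \<and> (v, y) \<in> parcs G \<and> (v, z) \<in> parcs G"
    "\<And>S. S \<subseteq> U \<Longrightarrow> S \<noteq> {} \<Longrightarrow>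
       (\<And>v. v \<in> S \<Longrightarrow> \<exists>y\<in>S. \<exists>z\<in>S. y \<noteq> z \<and> (v, y) \<in> parcs G \<and> (v, z) \<in> parcs G) \<Longrightarrow> S = U"
proof -
  obtain g where inj: "inj_on g {..<c}" and sub: "g ` {..<c} \<subseteq> pverts G"
    and arc: "\<And>t u. t < c \<Longrightarrow> u < c \<Longrightarrow> (t, u) \<in> parcs (cycle_graph c) \<longleftrightarrow> (g t, g u) \<in> parcs G"
    using assms(1) unfolding embeds_def by (auto simp: cycle_graph_def)
  have two: "\<exists>y\<in>g ` {..<c}. \<exists>z\<in>g ` {..<c}. y \<noteq> z \<and> (v, y) \<in> parcs G \<and> (v, z) \<in> parcs G"
    if v: "v \<in> g ` {..<c}" for v
  proof -
    from v obtain t where t: "t < c" "v = g t" by auto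
    obtain t' where t': "t' < c" "t' \<noteq> Suc t mod c"
      "\<And>u. (t, u) \<in> parcs (cycle_graph c) \<longleftrightarrow> u = Suc t mod c \<or> u = t'"
      using cycle_graph_neighbours[OF assms(2) t(1)] by blast
    have "Suc t mod c < c" using assms(2) by simp
    with t t' arc[of t t'] arc[of t "Suc t mod c"]
    have "g t' \<noteq> g (Suc t mod c)" "(v, g t') \<in> parcs G" "(v, g (Suc t mod c)) \<in> parcs G"
      using inj by (auto dest: inj_onD)
    with t'(1) \<open>Suc t mod c < c\<close> show ?thesis by blast
  qed
  have whole: "S = g ` {..<c}"
    if S: "S \<subseteq> g ` {..<c}" "S \<noteq> {}"
      "\<And>v. v \<in> S \<Longrightarrow> \<exists>y\<in>S. \<exists>z\<in>S. y \<noteq> z \<and> (v, y) \<in> parcs G \<and> (v, z) \<in> parcs G" for S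
  proof -
    let ?T = "{t. t < c \<and> g t \<in> S}"
    have "?T = {..<c}"
    proof (rule closed_under_Suc_mod_imp_all)
      fix t assume t: "t \<in> ?T"
      then obtain y z where yz: "y \<in> S" "z \<in> S" "y \<noteq> z" "(g t, y) \<in> parcs G" "(g t, z) \<in> parcs G"
        using S(3)[of "g t"] by auto
      then obtain t1 t2 where t12: "t1 < c" "t2 < c" "y = g t1" "z = g t2"
        using S(1) by blast
      obtain t' where t': "\<And>u. (t, u) \<in> parcs (cycle_graph c) \<longleftrightarrow> u = Suc t mod c \<or> u = t'"
        using cycle_graph_neighbours[OF assms(2), of t] t by blast
      \<comment> \<open>Two distinct neighbours of \<open>t\<close> cannot both be the other
        neighbour \<open>t'\<close>.\<close>
      have "t1 = Suc t mod c \<or> t2 = Suc t mod c"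
        using yz t12 t t'[of t1] t'[of t2] arc[of t t1] arc[of t t2] by blast
      with yz t12 show "Suc t mod c \<in> ?T" by auto
    qed (use S in auto)
    then have "g ` {..<c} \<subseteq> S" by auto
    with S(1) show ?thesis by blast
  qed
  show thesis
  proof (rule that[OF sub])
    show "card (g ` {..<c}) = c" using inj by (simp add: card_image)
  qed (rule two whole; assumption)+
qed

lemma embeds_cycle_graph_cycle_graph:
  assumes "embeds (cycle_graph c) (cycle_graph k)" "3 \<le> c" "3 \<le> k"
  shows "c = k"
proof -
  obtain U where U: "U \<subseteq> {..<k}" "card U = c"
    "\<And>v. v \<in> U \<Longrightarrow> \<exists>y\<in>U. \<exists>z\<in>U. y \<noteq> z \<and> (v, y) \<in> parcs (cycle_graph k) \<and> (v, z) \<in> parcs (cycle_graph k)"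
    using embedded_cycle_two_neighbours[OF assms(1,2)] by (auto simp: cycle_graph_def)
  have "U = {..<k}"
  proof (rule closed_under_Suc_mod_imp_all)
    fix t assume t: "t \<in> U"
    with U(1) have "t < k" by auto
    then obtain t' where "\<And>u. (t, u) \<in> parcs (cycle_graph k) \<longleftrightarrow> u = Suc t mod k \<or> u = t'"
      using cycle_graph_neighbours[OF assms(3)] by metis
    with U(3)[OF t] show "Suc t mod k \<in> U" by auto
  qed (use U assms(2) in auto)
  with U(2) show ?thesis by simp
qed

text \<open>A triangle is not a hole, so 3 is a cycle length of the class even when it belongs to
  \<open>C\<close>.\<close>

lemma mem_cyc_no_hole_class_iff: "k \<in> cyc (no_hole_class C) \<longleftrightarrow> k = 3 \<or> 4 \<le> k \<and> k \<notin> C"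
proof -
  have "embeds (cycle_graph k) (cycle_graph k)"
    unfolding embeds_def by (rule exI[of _ id]) simp
  then have "cycle_graph k \<in> no_hole_class C \<longleftrightarrow> k = 3 \<or> k \<notin> C" if "3 \<le> k"
    using that embeds_cycle_graph_cycle_graph[of _ k]
    by (force simp: mem_no_hole_class_iff pair_graph_cycle_graph)
  then show ?thesis unfolding cyc_def by auto
qed

subsection \<open>Orientations of cycles\<close>

text \<open>Every orientation of the cycle is coded by a word: \<open>w i\<close> tells whether the
  edge between \<open>i\<close> and its successor points forward.\<close>

definition oriented_cycle :: "nat \<Rightarrow> (nat \<Rightarrow> bool) \<Rightarrow> nat pair_pre_digraph" where
  "oriented_cycle l w = \<lparr> pverts = {..<l},
     parcs = {(i, j). i < l \<and> j < l \<and> (j = Suc i mod l \<and> w i \<or> i = Suc j mod l \<and> \<not> w j)} \<rparr>"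

lemma mk_symmetric_with_proj:
  "mk_symmetric (with_proj D) = \<lparr> pverts = pverts D, parcs = parcs D \<union> (parcs D)\<inverse> \<rparr>"
  unfolding mk_symmetric_def by fastforce

lemma orientation_of_oriented_cycle:
  assumes "3 \<le> l"
  shows "orientation_of (oriented_cycle l w) (cycle_graph l)"
proof -
  have "finite (parcs (oriented_cycle l w))"
    by (rule finite_subset[of _ "{..<l} \<times> {..<l}"]) (auto simp: oriented_cycle_def)
  then have "pair_digraph (oriented_cycle l w)"
    using assms
    by unfold_locales (auto simp: oriented_cycle_def mod_Suc split: if_splits)
  moreover have "(j, i) \<notin> parcs (oriented_cycle l w)" if "(i, j) \<in> parcs (oriented_cycle l w)" for i j
    using that assms by (auto simp: oriented_cycle_def mod_Suc split: if_splits)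
  moreover have "mk_symmetric (with_proj (oriented_cycle l w)) = cycle_graph l"
  proof -
    have "parcs (oriented_cycle l w) \<union> (parcs (oriented_cycle l w))\<inverse> = parcs (cycle_graph l)"
      by (auto simp: oriented_cycle_def cycle_graph_def)
    then show ?thesis
      by (simp add: mk_symmetric_with_proj oriented_cycle_def cycle_graph_def)
  qed
  ultimately show ?thesis
    unfolding orientation_of_def oriented_graph_def by blast
qed

text \<open>The potential \<open>h\<close> strictly increases along every nonempty walk, so no such
  walk is closed.\<close>

lemma acyclic_digraphI:
  fixes h :: "nat \<Rightarrow> int"
  assumes "\<And>u v. (u, v) \<in> parcs D \<Longrightarrow> h u < h v"
  shows "acyclic_digraph D"
proof -
  have "h u \<le> h v \<and> (p \<noteq> [] \<longrightarrow> h u < h v)" if "pcas u p v" "set p \<subseteq> parcs D" for u p v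
    using that
  proof (induction p arbitrary: u)
    case (Cons e p)
    then have "h u < h (snd e)" using assms[of u "snd e"] by (cases e) auto
    with Cons show ?case by fastforce
  qed simp
  then show ?thesis
    unfolding acyclic_digraph_def pre_digraph.cycle_def pre_digraph.awalk_def cas_with_proj_eq
    by fastforce
qed

text \<open>Vertex 0 is a source or a sink, so the signed height along the remaining path extends to an
  increasing labelling.\<close>

lemma acyclic_oriented_cycle:
  assumes "2 \<le> l" and turn: "w 0 \<noteq> w (l - 1)"
  shows "acyclic_digraph (oriented_cycle l w)"
proof -
  define g where "g t = (\<Sum>j<t. if w j then 1 else (-1::int))" for t
  \<comment> \<open>Since \<open>g t\<close> has absolute value at most \<open>t < l\<close>, the
    value at 0 lies below or above all others.\<close>
  define h where "h t = (if t = 0 then (if w 0 then - int l - 1 else int l + 1) else g t)" for t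
  have bound: "\<bar>g t\<bar> \<le> int t" for t
    by (induction t) (auto simp: g_def)
  have h0: "h 0 < h t" if "w 0" "0 < t" "t < l" for t
    using bound[of t] that by (auto simp: h_def)
  have h0': "h t < h 0" if "\<not> w 0" "0 < t" "t < l" for t
    using bound[of t] that by (auto simp: h_def)
  have step: "if w i then h i < h (Suc i mod l) else h (Suc i mod l) < h i" if i: "i < l" for i
  proof -
    consider "i = 0" | "0 < i" "Suc i = l" | "0 < i" "Suc i < l" by atomize_elim (use i in linarith)
    then show ?thesis
    proof cases
      case 1
      then show ?thesis using assms h0[of 1] h0'[of 1] by auto
    next
      case 2
      then have "i = l - 1" "Suc i mod l = 0" by auto
      then show ?thesis using 2 turn h0[of i] h0'[of i] by auto
    next
      case 3
      then show ?thesis by (auto simp: h_def g_def)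
    qed
  qed
  show ?thesis
    by (rule acyclic_digraphI[of _ h]) (auto simp: oriented_cycle_def dest: step)
qed

text \<open>An induced subdigraph of a cyclic orientation that misses a vertex is a disjoint union of runs
  of consecutive vertices; the run starting at \<open>s\<close> is placed on the \<open>s\<close>-th path.\<close>

lemma embeds_oriented_cycle_transfer:
  assumes emb: "embeds A (oriented_cycle l w)" and fin: "finite (pverts A)"
    and card: "card (pverts A) \<le> N" and "N < l"
    and p_in: "\<And>s j. s < l \<Longrightarrow> j < N \<Longrightarrow> p s j \<in> pverts D"
    and p_inj: "\<And>s s' j j'. s < l \<Longrightarrow> s' < l \<Longrightarrow> j < N \<Longrightarrow> j' < N \<Longrightarrow> p s j = p s' j' \<Longrightarrow> s = s' \<and> j = j'"
    and p_arc: "\<And>s s' j j'. s < l \<Longrightarrow> s' < l \<Longrightarrow> j < N \<Longrightarrow> j' < N \<Longrightarrow>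
      (p s j, p s' j') \<in> parcs D \<longleftrightarrow>
      s = s' \<and> (j' = Suc j \<and> w ((s + j) mod l) \<or> j = Suc j' \<and> \<not> w ((s + j') mod l))"
  shows "embeds A D"
proof -
  obtain f where f: "inj_on f (pverts A)" "f ` pverts A \<subseteq> {..<l}"
    and f_arc: "\<And>u v. u \<in> pverts A \<Longrightarrow> v \<in> pverts A \<Longrightarrow>
      (u, v) \<in> parcs A \<longleftrightarrow> (f u, f v) \<in> parcs (oriented_cycle l w)"
    using emb unfolding embeds_def by (auto simp: oriented_cycle_def)
  define U where "U = f ` pverts A"
  have U: "U \<subseteq> {..<l}" "finite U" "card U \<le> N"
    using f fin card by (auto simp: U_def card_image)
  \<comment> \<open>\<open>bk\<close> is the cyclic predecessor, \<open>J u\<close> the number of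
    steps from \<open>u\<close> back to the start of its run in \<open>U\<close>, and
    \<open>st u\<close> that start.\<close>
  define bk where "bk u = (u + l - 1) mod l" for u
  define J where "J u = (LEAST j. (bk ^^ Suc j) u \<notin> U)" for u
  define st where "st u = (bk ^^ J u) u" for u
  have l0: "0 < l" using \<open>N < l\<close> by simp
  have pr_lt: "bk u < l" for u using l0 by (simp add: bk_def)
  have Suc_pr: "Suc (bk u) mod l = u" if "u < l" for u
    using that l0 by (cases u) (auto simp: bk_def mod_Suc)
  have pr_Suc: "bk (Suc u mod l) = u" if "u < l" for u
    using that by (auto simp: bk_def mod_Suc)
  have pow_lt: "(bk ^^ j) u < l" if "u < l" for j u
    using that pr_lt by (cases j) auto
  have bk_add: "((bk ^^ j) u + j) mod l = u" if "u < l" for j u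
  proof (induction j)
    case (Suc j)
    have "((bk ^^ Suc j) u + Suc j) mod l = (Suc (bk ((bk ^^ j) u)) mod l + j) mod l"
      by (simp add: mod_simps)
    also have "\<dots> = u" using Suc Suc_pr[OF pow_lt[OF that]] by simp
    finally show ?case .
  qed (use that in simp)
  have pow_inj: "i = j" if "u < l" "i < l" "j < l" "(bk ^^ i) u = (bk ^^ j) u" for u i j
  proof -
    have "((bk ^^ i) u + i) mod l = ((bk ^^ i) u + j) mod l"
      using bk_add[OF that(1), of i] bk_add[OF that(1), of j] that(4) by simp
    then have "i mod l = j mod l"
      unfolding nat_mod_eq_iff by (simp add: add.assoc)
    then show ?thesis using that by simp
  qed
  \<comment> \<open>A run of \<open>N + 1\<close> vertices would be too large for \<open>U\<close>;
    its vertices are distinct because \<open>N < l\<close>.\<close>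
  have small: "i < N" if u: "u \<in> U" and run: "\<And>j. j \<le> i \<Longrightarrow> (bk ^^ j) u \<in> U" for u i
  proof (rule ccontr)
    assume "\<not> i < N"
    then have "(\<lambda>j. (bk ^^ j) u) ` {..N} \<subseteq> U" using run by auto
    moreover have "inj_on (\<lambda>j. (bk ^^ j) u) {..N}"
      using pow_inj[of u] u U(1) \<open>N < l\<close> by (auto simp: inj_on_def)
    ultimately have "card {..N} \<le> card U"
      using U(2) by (metis card_image card_mono)
    with U(3) show False by simp
  qed
  have ex: "\<exists>j. (bk ^^ Suc j) u \<notin> U" if "u \<in> U" for u
  proof (rule ccontr)
    assume "\<not> ?thesis"
    then have "(bk ^^ j) u \<in> U" for j using that by (cases j) auto
    then show False using small[OF that, of N] by blast
  qed
  have run: "(bk ^^ j) u \<in> U" if "u \<in> U" "j \<le> J u" for u j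
    using that not_less_Least[of "j - 1" "\<lambda>j. (bk ^^ Suc j) u \<notin> U"]
    by (cases j) (auto simp: J_def)
  have J_lt: "J u < N" if "u \<in> U" for u using small[OF that run[OF that]] .
  have st_lt: "st u < l" if "u \<in> U" for u using that U(1) pow_lt unfolding st_def by auto
  have st_J: "(st u + J u) mod l = u" if "u \<in> U" for u
    using that U(1) bk_add unfolding st_def by auto
  have next_run: "J v = Suc (J u)" "st v = st u" if uv: "u \<in> U" "v \<in> U" "v = Suc u mod l" for u v
  proof -
    have pv: "bk v = u" using uv U(1) pr_Suc by auto
    obtain j where "(bk ^^ Suc j) v \<notin> U" using ex[OF uv(2)] by blast
    then have "J v = Suc (LEAST j. (bk ^^ Suc (Suc j)) v \<notin> U)"
      unfolding J_def by (rule Least_Suc) (use pv uv in simp)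
    also have "\<dots> = Suc (J u)"
      unfolding J_def funpow_Suc_right[of "Suc _"] by (simp only: o_def pv)
    finally show *: "J v = Suc (J u)" .
    show "st v = st u" unfolding st_def * funpow_Suc_right by (simp add: pv)
  qed
  have st_inj: "u = v" if "u \<in> U" "v \<in> U" "st u = st v" "J u = J v" for u v
    using st_J that by metis
  define q where "q u = p (st u) (J u)" for u
  have arc: "(u, v) \<in> parcs (oriented_cycle l w) \<longleftrightarrow> (q u, q v) \<in> parcs D"
    if uv: "u \<in> U" "v \<in> U" for u v
  proof -
    \<comment> \<open>Adjacency on the cycle becomes adjacency on a path: same run, consecutive
      offsets.\<close>
    have follow: "v' = Suc u' mod l \<longleftrightarrow> st u' = st v' \<and> J v' = Suc (J u')"
      if "u' \<in> U" "v' \<in> U" for u' v'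
    proof
      assume "st u' = st v' \<and> J v' = Suc (J u')"
      then show "v' = Suc u' mod l"
        using st_J[OF that(1)] st_J[OF that(2)] by (metis add_Suc_right mod_Suc_eq)
    qed (use next_run[OF that] in auto)
    have "(q u, q v) \<in> parcs D \<longleftrightarrow>
      st u = st v \<and> (J v = Suc (J u) \<and> w u \<or> J u = Suc (J v) \<and> \<not> w v)"
      unfolding q_def p_arc[OF st_lt[OF uv(1)] st_lt[OF uv(2)] J_lt[OF uv(1)] J_lt[OF uv(2)]]
      using st_J[OF uv(1)] st_J[OF uv(2)] by metis
    also have "\<dots> \<longleftrightarrow> v = Suc u mod l \<and> w u \<or> u = Suc v mod l \<and> \<not> w v"
      unfolding follow[OF uv] follow[OF uv(2,1)] by auto
    finally show ?thesis using uv U(1) by (auto simp: oriented_cycle_def)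
  qed
  have q_inj: "inj_on q U"
    using p_inj st_lt J_lt st_inj unfolding q_def inj_on_def by metis
  have "inj_on (q \<circ> f) (pverts A)" using f(1) q_inj unfolding U_def by (rule comp_inj_on)
  moreover have "(q \<circ> f) ` pverts A \<subseteq> pverts D"
    using p_in st_lt J_lt unfolding q_def U_def by auto
  moreover have "(u, v) \<in> parcs A \<longleftrightarrow> ((q \<circ> f) u, (q \<circ> f) v) \<in> parcs D"
    if "u \<in> pverts A" "v \<in> pverts A" for u v
    using f_arc[OF that] arc[of "f u" "f v"] that unfolding U_def by simp
  ultimately show ?thesis unfolding embeds_def by blast
qed

subsection \<open>Spiders with lasso-shaped legs\<close>

text \<open>Positions \<open>0..n\<close> form the path and \<open>n..n + k - 1\<close> the cycle of
  a leg, which share the junction \<open>n\<close>. The edges of a leg join each position to its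
  \<open>lasso_next\<close>.\<close>

definition lasso_next :: "nat \<Rightarrow> nat \<Rightarrow> nat \<Rightarrow> nat" where
  "lasso_next n k p = (if Suc p = n + k then n else Suc p)"

text \<open>The vertex at position \<open>p\<close> of leg \<open>a\<close> of spider \<open>i\<close>; position 0 is shared by all legs.\<close>

definition spider_vertex :: "nat \<Rightarrow> nat \<Rightarrow> nat \<Rightarrow> nat" where
  "spider_vertex i a p = prod_encode (i, prod_encode (if p = 0 then 0 else a, p))"

definition lasso_spiders :: "nat \<Rightarrow> nat \<Rightarrow> nat \<Rightarrow> nat \<Rightarrow> nat pair_pre_digraph" where
  "lasso_spiders I L n k = \<lparr>
     pverts = {spider_vertex i a p | i a p. i < I \<and> a < L \<and> p < n + k},
     parcs = {(spider_vertex i a p, spider_vertex i a q) | i a p q.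
       i < I \<and> a < L \<and> p < n + k \<and> q < n + k \<and> (q = lasso_next n k p \<or> p = lasso_next n k q)} \<rparr>"

lemma spider_vertex_eq_iff:
  "spider_vertex i a p = spider_vertex j b q \<longleftrightarrow> i = j \<and> p = q \<and> (p = 0 \<or> a = b)"
  by (auto simp: spider_vertex_def)

text \<open>The leg index of a root is arbitrary, so equality of the legs can only be claimed away
  from position 0.\<close>

lemma lasso_spiders_arcD:
  assumes "(spider_vertex i a p, spider_vertex j b q) \<in> parcs (lasso_spiders I L n k)"
  shows "i = j \<and> i < I \<and> p < n + k \<and> q < n + k \<and> (q = lasso_next n k p \<or> p = lasso_next n k q) \<and>
    (p = 0 \<or> q = 0 \<or> a = b)"
  using assms by (auto simp: lasso_spiders_def spider_vertex_eq_iff)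

lemma lasso_spiders_arcI:
  assumes "i < I" "a < L" "p < n + k" "q < n + k" "q = lasso_next n k p \<or> p = lasso_next n k q"
  shows "(spider_vertex i a p, spider_vertex i a q) \<in> parcs (lasso_spiders I L n k)"
  using assms unfolding lasso_spiders_def by auto

lemma pair_graph_lasso_spiders:
  assumes "2 \<le> k"
  shows "pair_graph (lasso_spiders I L n k)"
proof -
  have fin: "finite (pverts (lasso_spiders I L n k))"
    by (rule finite_subset[of _ "(\<lambda>(i, a, p). spider_vertex i a p) ` ({..<I} \<times> {..<L} \<times> {..<n + k})"])
      (force simp: lasso_spiders_def, simp)
  have sub: "parcs (lasso_spiders I L n k) \<subseteq>
      pverts (lasso_spiders I L n k) \<times> pverts (lasso_spiders I L n k)"
    by (auto simp: lasso_spiders_def)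
  show ?thesis
  proof
    show "finite (parcs (lasso_spiders I L n k))" using finite_subset[OF sub] fin by blast
    show "symmetric (with_proj (lasso_spiders I L n k))"
      unfolding symmetric_def sym_def by (auto simp: lasso_spiders_def)
    show "fst e \<noteq> snd e" if "e \<in> parcs (lasso_spiders I L n k)" for e
      using that assms
      by (auto simp: lasso_spiders_def spider_vertex_eq_iff lasso_next_def split: if_splits)
  qed (use fin sub in auto)
qed

text \<open>If an embedded cycle has a vertex beyond a junction, it must continue both ways around
  that \<open>k\<close>-cycle, and minimality makes it equal to it. Otherwise it lies in a forest of
  subdivided stars, where a vertex farthest from its root has only one neighbour left.\<close>

lemma embeds_cycle_graph_lasso_spiders:
  assumes emb: "embeds (cycle_graph c) (lasso_spiders I L n k)" and "3 \<le> c" "0 < n" "3 \<le> k"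
  shows "c = k"
proof -
  let ?G = "lasso_spiders I L n k" and ?v = spider_vertex
  obtain U where U: "U \<subseteq> pverts ?G" "card U = c"
    and two: "\<And>v. v \<in> U \<Longrightarrow> \<exists>y\<in>U. \<exists>z\<in>U. y \<noteq> z \<and> (v, y) \<in> parcs ?G \<and> (v, z) \<in> parcs ?G"
    and whole: "\<And>S. S \<subseteq> U \<Longrightarrow> S \<noteq> {} \<Longrightarrow>
       (\<And>v. v \<in> S \<Longrightarrow> \<exists>y\<in>S. \<exists>z\<in>S. y \<noteq> z \<and> (v, y) \<in> parcs ?G \<and> (v, z) \<in> parcs ?G) \<Longrightarrow> S = U"
    using embedded_cycle_two_neighbours[OF emb \<open>3 \<le> c\<close>] by blast
  have coord: "\<exists>i a p. v = ?v i a p \<and> i < I \<and> a < L \<and> p < n + k" if "v \<in> U" for v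
    using that U(1) by (auto simp: lasso_spiders_def)
  have U_nonempty: "U \<noteq> {}" using U(2) \<open>3 \<le> c\<close> by auto
  show ?thesis
  proof (cases "\<exists>i a p. ?v i a p \<in> U \<and> n < p")
    case True
    then obtain i a p where p: "?v i a p \<in> U" "n < p" by blast
    from coord[OF p(1)] p(2) have ia: "i < I" "a < L" "p < n + k"
      by (auto simp: spider_vertex_eq_iff)
    have both: "?v i a (r - 1) \<in> U \<and> ?v i a (lasso_next n k r) \<in> U"
      if r: "?v i a r \<in> U" "n < r" "r < n + k" for r
    proof -
      obtain y z where yz: "y \<in> U" "z \<in> U" "y \<noteq> z" "(?v i a r, y) \<in> parcs ?G" "(?v i a r, z) \<in> parcs ?G"
        using two[OF r(1)] by blast
      have "x = ?v i a (r - 1) \<or> x = ?v i a (lasso_next n k r)" if x: "x \<in> U" "(?v i a r, x) \<in> parcs ?G" for x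
      proof -
        obtain i' a' q where q: "x = ?v i' a' q" using coord[OF x(1)] by blast
        with x(2) lasso_spiders_arcD have
          "i = i'" "r = 0 \<or> q = 0 \<or> a = a'" "q = lasso_next n k r \<or> r = lasso_next n k q"
          by blast+
        with r(2) show ?thesis
          unfolding q spider_vertex_eq_iff by (auto simp: lasso_next_def split: if_splits)
      qed
      from this[of y] this[of z] yz show ?thesis by metis
    qed
    have down: "?v i a (p - d) \<in> U" if "d \<le> p - n" for d
      using that
    proof (induction d)
      case (Suc d)
      then show ?case using both[of "p - d"] ia(3) by auto
    qed (use p in simp)
    have up: "?v i a (p + d) \<in> U" if "p + d < n + k" for d
      using that
    proof (induction d)
      case (Suc d)
      then show ?case using both[of "p + d"] p(2) by (auto simp: lasso_next_def)
    qed (use p in simp)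
    let ?S = "?v i a ` {n..<n + k}"
    have "?S \<subseteq> U"
    proof
      fix x assume "x \<in> ?S"
      then obtain r where r: "x = ?v i a r" "n \<le> r" "r < n + k" by auto
      show "x \<in> U"
      proof (cases "r \<le> p")
        case True
        then show ?thesis using down[of "p - r"] r by auto
      next
        case False
        then show ?thesis using up[of "r - p"] r by auto
      qed
    qed
    moreover have "?S \<noteq> {}" using \<open>3 \<le> k\<close> by auto
    moreover have "\<exists>y\<in>?S. \<exists>z\<in>?S. y \<noteq> z \<and> (v, y) \<in> parcs ?G \<and> (v, z) \<in> parcs ?G" if v: "v \<in> ?S" for v
    proof -
      obtain r where r: "v = ?v i a r" "n \<le> r" "r < n + k" using v by auto
      \<comment> \<open>\<open>r'\<close> is the predecessor of \<open>r\<close> on the cycle; that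
        of the junction \<open>n\<close> is \<open>n + k - 1\<close>.\<close>
      define r' where "r' = (if r = n then n + k - 1 else r - 1)"
      have next_r: "lasso_next n k r \<in> {n..<n + k}" "r' \<in> {n..<n + k}" "lasso_next n k r' = r"
        "r' \<noteq> lasso_next n k r"
        using r(2,3) \<open>3 \<le> k\<close> by (auto simp: r'_def lasso_next_def)
      then have "?v i a r' \<noteq> ?v i a (lasso_next n k r)" by (simp add: spider_vertex_eq_iff)
      moreover have "(v, ?v i a r') \<in> parcs ?G" "(v, ?v i a (lasso_next n k r)) \<in> parcs ?G"
        using r next_r ia by (auto intro!: lasso_spiders_arcI)
      ultimately show ?thesis using next_r(1,2) by blast
    qed
    ultimately have "?S = U" by (rule whole)
    moreover have "card ?S = k"
      by (subst card_image) (auto simp: inj_on_def spider_vertex_eq_iff)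
    ultimately show ?thesis using U(2) by simp
  next
    case False
    then have le: "p \<le> n" if "?v i a p \<in> U" for i a p using that by (meson not_le)
    define R where "R = {p. \<exists>i a. ?v i a p \<in> U}"
    have "finite R" by (rule finite_subset[of _ "{..n}"]) (auto simp: R_def dest: le)
    moreover have "R \<noteq> {}" using U_nonempty coord unfolding R_def by blast
    ultimately have "Max R \<in> R" by (rule Max_in)
    then obtain i a where top: "?v i a (Max R) \<in> U" unfolding R_def by blast
    have max: "q \<le> Max R" if "?v j b q \<in> U" for j b q
      using that \<open>finite R\<close> by (intro Max_ge) (auto simp: R_def)
    have "x = ?v i a (Max R - 1)" if x: "x \<in> U" "(?v i a (Max R), x) \<in> parcs ?G" for x
    proof -
      obtain i' a' q where q: "x = ?v i' a' q" using coord[OF x(1)] by blast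
      with x(2) lasso_spiders_arcD have adj: "i = i'" "Max R = 0 \<or> q = 0 \<or> a = a'"
          "q = lasso_next n k (Max R) \<or> Max R = lasso_next n k q" by blast+
      have "q \<le> Max R" "Max R \<le> n" using max le top x(1) q by blast+
      with adj show ?thesis
        unfolding q spider_vertex_eq_iff using \<open>0 < n\<close> \<open>3 \<le> k\<close>
        by (auto simp: lasso_next_def split: if_splits)
    qed
    with two[OF top] show ?thesis by metis
  qed
qed

text \<open>Positions visited by the closed walk that leaves the root, runs down a leg, turns \<open>m\<close> times
  around the cycle and returns to the root, in \<open>2 n + m k\<close> steps.\<close>

definition lasso_walk :: "nat \<Rightarrow> nat \<Rightarrow> nat \<Rightarrow> nat \<Rightarrow> nat" where
  "lasso_walk n k m t =
     (if t \<le> n then t else if t \<le> n + m * k then n + (t - n) mod k else 2 * n + m * k - t)"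

lemma lasso_walk_lt:
  assumes "0 < n" "0 < k" "t \<le> 2 * n + m * k"
  shows "lasso_walk n k m t < n + k"
  using assms by (auto simp: lasso_walk_def)

lemma lasso_walk_Suc_forward:
  assumes "0 < n" "2 \<le> k" "t < n + m * k"
  shows "lasso_walk n k m (Suc t) = lasso_next n k (lasso_walk n k m t)"
proof (cases "t < n")
  case False
  then have "Suc (t - n) = Suc t - n" by simp
  then show ?thesis using False assms mod_Suc[of "t - n" k]
    by (auto simp: lasso_walk_def lasso_next_def)
qed (use assms in \<open>auto simp: lasso_walk_def lasso_next_def\<close>)

lemma lasso_walk_Suc_backward:
  assumes "0 < n" "2 \<le> k" "n + m * k \<le> t" "t < 2 * n + m * k"
  shows "lasso_walk n k m t = lasso_next n k (lasso_walk n k m (Suc t))"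
  using assms by (cases "t = n + m * k") (auto simp: lasso_walk_def lasso_next_def)

text \<open>Within a window two times differ by at most \<open>N - 1 \<le> k - 3\<close>. This is
  too little to return to a vertex of the \<open>k\<close>-cycle, or to a neighbour of it from the
  other side, so the window traces an induced path.\<close>

lemma lasso_walk_window:
  assumes "N + 2 \<le> k" "t < u" "u < t + N" "u \<le> 2 * n + m * k" "N \<le> n" "0 < m"
  shows "lasso_walk n k m t \<noteq> lasso_walk n k m u"
    and "lasso_walk n k m u = lasso_next n k (lasso_walk n k m t) \<or>
      lasso_walk n k m t = lasso_next n k (lasso_walk n k m u) \<Longrightarrow> u = Suc t"
proof -
  have mk: "k \<le> m * k" using \<open>0 < m\<close> by simp
  define d where "d = u - t"
  have d: "u = t + d" "0 < d" "d < N" using assms by (auto simp: d_def)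
  \<comment> \<open>The cases locate the window relative to the times \<open>n\<close> and
    \<open>n + m * k\<close> at which the walk enters and leaves the cycle.\<close>
  consider (out) "u \<le> n" | (enter) "t < n" "n < u" | (round) "n \<le> t" "u \<le> n + m * k"
    | (leave) "n \<le> t" "t \<le> n + m * k" "n + m * k < u" | (home) "n + m * k < t"
    by atomize_elim auto
  then have "lasso_walk n k m t \<noteq> lasso_walk n k m u \<and>
    (lasso_walk n k m u = lasso_next n k (lasso_walk n k m t) \<or>
      lasso_walk n k m t = lasso_next n k (lasso_walk n k m u) \<longrightarrow> u = Suc t)"
  proof cases
    case out
    then show ?thesis using assms by (auto simp: lasso_walk_def lasso_next_def)
  next
    case enter
    then have "u - n < k" "u \<le> n + m * k" using assms mk by linarith+
    then have "lasso_walk n k m u = u" "lasso_walk n k m t = t"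
      using enter by (auto simp: lasso_walk_def)
    then show ?thesis using assms enter by (auto simp: lasso_next_def)
  next
    case round
    define r where "r = (t - n) mod k"
    have r: "r < k" using assms by (simp add: r_def)
    have t: "lasso_walk n k m t = n + r" using round d by (auto simp: lasso_walk_def r_def)
    have "(u - n) mod k = (r + d) mod k"
      using round d by (simp add: r_def mod_simps)
    also have "\<dots> = (if r + d < k then r + d else r + d - k)"
      using r d assms by (simp add: mod_if)
    finally have u: "lasso_walk n k m u = n + (if r + d < k then r + d else r + d - k)"
      using round d by (auto simp: lasso_walk_def)
    show ?thesis unfolding t u using r d assms by (auto simp: lasso_next_def split: if_splits)
  next
    \<comment> \<open>\<open>e\<close> counts the steps still to be made before the cycle is left,
      so the position is found by counting back from the junction.\<close>
    case leave
    define e where "e = n + m * k - t"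
    have e: "e < N" "t = n + m * k - e" "e \<le> m * k" using leave assms by (auto simp: e_def)
    have "(m * k - e) mod k = (if e = 0 then 0 else k - e)"
    proof (cases "e = 0")
      case False
      have "m * k - e = (m - 1) * k + (k - e)"
        using \<open>0 < m\<close> e assms by (cases m) auto
      then show ?thesis using False assms e by (simp only: mod_mult_self3) simp
    qed simp
    then have t: "lasso_walk n k m t = (if e = 0 then n else n + k - e)"
      using leave e assms by (auto simp: lasso_walk_def)
    have u: "lasso_walk n k m u = 2 * n + m * k - u" using leave by (simp add: lasso_walk_def)
    show ?thesis unfolding t u using leave e assms by (auto simp: lasso_next_def split: if_splits)
  next
    case home
    then show ?thesis using assms by (auto simp: lasso_walk_def lasso_next_def)
  qed
  then show "lasso_walk n k m t \<noteq> lasso_walk n k m u"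
    and "lasso_walk n k m u = lasso_next n k (lasso_walk n k m t) \<or>
      lasso_walk n k m t = lasso_next n k (lasso_walk n k m u) \<Longrightarrow> u = Suc t"
    by blast+
qed

subsection \<open>Cycle lengths of expressible classes\<close>

text \<open>\<open>N + 2 \<le> k\<close> keeps windows from closing up around the cycle, and
  \<open>N \<le> n\<close> keeps windows through the root on the straight parts of the legs.\<close>

lemma cycle_graph_closed_under_lasso_walk:
  assumes F: "\<forall>A\<in>F. oriented_graph A" "\<forall>A\<in>F. card (pverts A) \<le> N"
    and expr: "\<forall>G. pair_graph G \<longrightarrow>
      (G \<in> no_hole_class C \<longleftrightarrow> (\<exists>D. orientation_of D G \<and> acyclic_digraph D \<and> free_of F D))"
    and k: "4 \<le> k" "k \<notin> C" "N + 2 \<le> k" and n: "0 < n" "N \<le> n" and m: "0 < m"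
  shows "cycle_graph (2 * n + m * k) \<in> no_hole_class C"
proof -
  define l where "l = 2 * n + m * k"
  have mk: "k \<le> m * k" using m by simp
  have l: "N < l" "3 \<le> l" "0 < l" using mk k unfolding l_def by linarith+
  let ?v = spider_vertex and ?nx = "lasso_next n k" and ?lw = "lasso_walk n k m"
  \<comment> \<open>\<open>B\<close> holds the possible patterns of a leg. One leg more than there
    are patterns forces twins in each spider, and \<open>l * card B\<close> spiders leave
    \<open>l\<close> with the same twin pattern, one for each possible start of a run.\<close>
  define B where "B = Pow {..<n + k}"
  define L where "L = Suc (card B)"
  define I where "I = l * card B"
  define G where "G = lasso_spiders I L n k"
  have B: "finite B" "B \<noteq> {}" "0 < card B" by (auto simp: B_def card_gt_0_iff)
  have G: "pair_graph G" unfolding G_def using k by (intro pair_graph_lasso_spiders) simp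
  moreover have "G \<in> no_hole_class C"
    using embeds_cycle_graph_lasso_spiders[of _ I L n k] n(1) k G
    unfolding G_def[symmetric] mem_no_hole_class_iff by fastforce
  ultimately obtain D where D: "orientation_of D G" "free_of F D" using expr by blast
  from D(1) have D_or: "oriented_graph D" and D_verts: "pverts D = pverts G"
    and D_arcs: "parcs D \<union> (parcs D)\<inverse> = parcs G"
    unfolding orientation_of_def mk_symmetric_with_proj by auto
  have G_arc: "(x, y) \<in> parcs G \<longleftrightarrow> (x, y) \<in> parcs D \<or> (y, x) \<in> parcs D" for x y
    unfolding D_arcs[symmetric] by blast
  have D_asym: "(x, y) \<in> parcs D \<Longrightarrow> (y, x) \<notin> parcs D" for x y
    using D_or by (auto simp: oriented_graph_def)
  have nx_lt: "?nx q < n + k" if "q < n + k" for q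
    using that k by (auto simp: lasso_next_def)

  define col where "col i a = {q. q < n + k \<and> (?v i a q, ?v i a (?nx q)) \<in> parcs D}" for i a
  have col_B: "col i a \<in> B" for i a by (auto simp: col_def B_def)
  have "\<exists>a b. a < L \<and> b < L \<and> a \<noteq> b \<and> col i a = col i b" for i
  proof -
    have "card (col i ` {..<L}) \<le> card B" using col_B B(1) by (intro card_mono) auto
    then have "\<not> inj_on (col i) {..<L}" by (intro pigeonhole) (simp add: L_def)
    then show ?thesis by (auto simp: inj_on_def)
  qed
  then obtain a b where ab: "\<And>i. a i < L" "\<And>i. b i < L" "\<And>i. a i \<noteq> b i"
    "\<And>i. col i (a i) = col i (b i)" by metis
  obtain Y where Y: "card {..<I} \<le> card ((\<lambda>i. col i (a i)) -` {Y} \<inter> {..<I}) * card B"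
    using pigeonhole_card[of "\<lambda>i. col i (a i)" "{..<I}" B] col_B B by auto
  then have "card {..<l} \<le> card ((\<lambda>i. col i (a i)) -` {Y} \<inter> {..<I})"
    using B(3) by (simp add: I_def)
  \<comment> \<open>\<open>e\<close> lists \<open>l\<close> distinct spiders whose twin legs all
    have pattern \<open>Y\<close>.\<close>
  then obtain e where e_inj: "inj_on e {..<l}"
    and e: "e ` {..<l} \<subseteq> (\<lambda>i. col i (a i)) -` {Y} \<inter> {..<I}"
    using inj_on_iff_card_le[of "{..<l}" "(\<lambda>i. col i (a i)) -` {Y} \<inter> {..<I}"] by auto

  \<comment> \<open>After time \<open>n + m * k\<close> edges are traversed against
    \<open>lasso_next\<close>, so the pattern is read at the later position and negated.\<close>
  define w where "w t = (if t < n + m * k then ?lw t \<in> Y else ?lw (Suc t) \<notin> Y)" for t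
  \<comment> \<open>Time runs over two rounds, the first on leg \<open>a i\<close> and the second on
    its twin \<open>b i\<close>, so that a window starting in the first round may pass the
    root.\<close>
  define leg where "leg i T = (if T < l then a i else b i)" for i T
  define walk where "walk i T = ?v i (leg i T) (?lw (T mod l))" for i T
  have leg_lt: "leg i T < L" for i T using ab by (simp add: leg_def)
  have lw_lt: "?lw (T mod l) < n + k" for T
  proof -
    have "T mod l < l" using l(3) by simp
    then show ?thesis using n k by (intro lasso_walk_lt) (auto simp: l_def)
  qed
  have lw_0: "?lw 0 = 0" "?lw l = 0" using n mk k by (auto simp: lasso_walk_def l_def)
  \<comment> \<open>Both twins have pattern \<open>Y\<close>, so the direction of the edge at time
    \<open>T\<close> depends only on \<open>T mod l\<close>.\<close>
  have step: "((walk i T, walk i (Suc T)) \<in> parcs D \<longleftrightarrow> w (T mod l)) \<and>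
      ((walk i (Suc T), walk i T) \<in> parcs D \<longleftrightarrow> \<not> w (T mod l))"
    if i: "i < I" "col i (a i) = Y" and T: "T < 2 * l" for i T
  proof -
    let ?g = "leg i T" and ?t = "T mod l"
    have t: "?t < l" using l(3) by simp
    have "col i ?g = Y" using i ab(4) by (simp add: leg_def)
    then have fwd: "(?v i ?g q, ?v i ?g (?nx q)) \<in> parcs D \<longleftrightarrow> q \<in> Y" if "q < n + k" for q
      using that by (auto simp: col_def)
    have bwd: "(?v i ?g (?nx q), ?v i ?g q) \<in> parcs D \<longleftrightarrow> q \<notin> Y" if "q < n + k" for q
    proof -
      have "(?v i ?g q, ?v i ?g (?nx q)) \<in> parcs G"
        unfolding G_def using i leg_lt that nx_lt by (intro lasso_spiders_arcI) auto
      then show ?thesis using fwd[OF that] G_arc D_asym by blast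
    qed
    \<comment> \<open>When a round ends the leg may change, but the vertex reached is the root,
      common to all legs.\<close>
    have next_v: "walk i (Suc T) = ?v i ?g (?lw (Suc ?t))"
    proof (cases "Suc ?t = l")
      case True
      then have "Suc T mod l = 0" by (simp add: mod_Suc)
      then show ?thesis using True lw_0 by (simp add: walk_def spider_vertex_eq_iff)
    next
      case False
      then have "Suc T mod l = Suc ?t" by (simp add: mod_Suc)
      moreover have "leg i (Suc T) = ?g"
        using False by (cases "T < l") (auto simp: leg_def)
      ultimately show ?thesis by (simp add: walk_def)
    qed
    have lw_Suc: "?lw (Suc ?t) < n + k"
      using t n k unfolding l_def by (intro lasso_walk_lt) linarith+
    show ?thesis
    proof (cases "?t < n + m * k")
      case True
      then have "?lw (Suc ?t) = ?nx (?lw ?t)" using n k by (intro lasso_walk_Suc_forward) auto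
      then show ?thesis using True fwd[OF lw_lt] bwd[OF lw_lt]
        unfolding next_v by (simp add: w_def walk_def)
    next
      case False
      then have "?lw ?t = ?nx (?lw (Suc ?t))"
        using n k t by (intro lasso_walk_Suc_backward) (auto simp: l_def)
      then show ?thesis using False fwd[OF lw_Suc] bwd[OF lw_Suc]
        unfolding next_v by (simp add: w_def walk_def)
    qed
  qed
  have apart: "walk i T \<noteq> walk i U \<and> ((walk i T, walk i U) \<in> parcs G \<longrightarrow> U = Suc T)"
    if TU: "T < U" "U < T + N" "U < 2 * l" for i T U
  proof -
    consider "U < l \<or> l \<le> T" | "T < l" "l \<le> U" by linarith
    then show ?thesis
    proof cases
      case 1
      then have legs: "leg i T = leg i U" using TU by (auto simp: leg_def)
      have "\<exists>t. T mod l = t \<and> U mod l = t + (U - T) \<and> U mod l < l"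
      proof (cases "U < l")
        case False
        with 1 TU have "T = (T - l) + l" "U = (U - l) + l" "T - l < l" "U - l < l" by auto
        then have "T mod l = T - l" "U mod l = U - l" by (metis mod_add_self2 mod_less)+
        then show ?thesis using False 1 TU by auto
      qed (use TU in auto)
      then have win: "T mod l < U mod l" "U mod l < T mod l + N" "U mod l \<le> 2 * n + m * k"
        "U mod l = Suc (T mod l) \<longleftrightarrow> U = Suc T"
        using TU unfolding l_def[symmetric] by linarith+
      note window = lasso_walk_window[OF k(3) win(1,2,3) n(2) m]
      show ?thesis
        using window win(4) lasso_spiders_arcD[of i _ _ i] unfolding walk_def spider_vertex_eq_iff G_def
        by blast
    next
      case 2
      \<comment> \<open>The window crosses the root: it comes home along \<open>a i\<close> and
        leaves along \<open>b i\<close>. Distinct legs meet only at the root, so the only possible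
        edge is the last one into it.\<close>
      then have T: "n + m * k < T" using TU n unfolding l_def by linarith
      have "T mod l = T" "U mod l = U - l" using 2 TU by (auto simp: mod_if)
      moreover have "?lw T = l - T" using T n 2 by (auto simp: lasso_walk_def l_def)
      moreover have "?lw (U - l) = U - l" using TU 2 n by (auto simp: lasso_walk_def)
      ultimately have wT: "walk i T = ?v i (a i) (l - T)" and wU: "walk i U = ?v i (b i) (U - l)"
        using 2 by (auto simp: walk_def leg_def)
      have "U = Suc T" if "(walk i T, walk i U) \<in> parcs G"
      proof -
        from lasso_spiders_arcD[OF that[unfolded wT wU G_def]] ab(3)[of i] 2
        have "U = l" "0 = ?nx (l - T) \<or> l - T = ?nx 0" by auto
        then show ?thesis using n k 2 by (auto simp: lasso_next_def split: if_splits)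
      qed
      then show ?thesis using 2 ab(3)[of i] unfolding wT wU spider_vertex_eq_iff by auto
    qed
  qed
  \<comment> \<open>The path for runs starting at \<open>s\<close> follows the walk from time
    \<open>s\<close> in its own spider \<open>e s\<close>; distinct spiders are disjoint and have no
    edges between them.\<close>
  define p where "p s j = walk (e s) (s + j)" for s j
  have e_lt: "e s < I" "col (e s) (a (e s)) = Y" if "s < l" for s using e that by auto
  have p_in: "p s j \<in> pverts D" if "s < l" for s j
    using e_lt(1)[OF that] leg_lt lw_lt
    unfolding D_verts G_def p_def walk_def lasso_spiders_def by simp blast
  have e_eq: "e s = e s' \<longleftrightarrow> s = s'" if "s < l" "s' < l" for s s'
    using e_inj that by (auto dest: inj_onD)
  have p_inj: "s = s' \<and> j = j'"
    if "s < l" "s' < l" "j < N" "j' < N" "p s j = p s' j'" for s s' j j'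
  proof -
    from that(5) have "e s = e s'" by (simp add: p_def walk_def spider_vertex_eq_iff)
    with e_eq that(1,2) have "s = s'" by blast
    with apart[of "s + j" "s + j'" "e s"] apart[of "s + j'" "s + j" "e s"] that l(1)
    show ?thesis unfolding p_def by (cases j j' rule: linorder_cases) auto
  qed
  have p_arc: "(p s j, p s' j') \<in> parcs D \<longleftrightarrow>
      s = s' \<and> (j' = Suc j \<and> w ((s + j) mod l) \<or> j = Suc j' \<and> \<not> w ((s + j') mod l))"
    if b: "s < l" "s' < l" "j < N" "j' < N" for s s' j j'
  proof (cases "s = s'")
    case False
    have "(p s j, p s' j') \<notin> parcs G"
    proof
      assume "(p s j, p s' j') \<in> parcs G"
      then have "e s = e s'" unfolding G_def p_def walk_def by (blast dest: lasso_spiders_arcD)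
      with False e_eq b show False by blast
    qed
    then show ?thesis using False G_arc by blast
  next
    case True
    note st = step[OF e_lt[OF b(1)]]
    have far: "s + j < 2 * l" "s + j' < 2 * l" using b l(1) by auto
    show ?thesis
    proof (cases j j' rule: linorder_cases)
      case less
      show ?thesis
      proof (cases "j' = Suc j")
        case True
        then show ?thesis using \<open>s = s'\<close> st[OF far(1)] by (simp add: p_def)
      next
        case False
        then have "(p s j, p s' j') \<notin> parcs G"
          using less apart[of "s + j" "s + j'" "e s"] far b \<open>s = s'\<close> by (auto simp: p_def)
        then show ?thesis using False less G_arc by auto
      qed
    next
      case equal
      have "(p s j, p s j) \<notin> parcs D" using D_asym by blast
      with equal True show ?thesis by auto
    next
      case greater
      show ?thesis
      proof (cases "j = Suc j'")
        case True
        then show ?thesis using \<open>s = s'\<close> st[OF far(2)] by (simp add: p_def)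
      next
        case False
        then have "(p s' j', p s j) \<notin> parcs G"
          using greater apart[of "s + j'" "s + j" "e s"] far b \<open>s = s'\<close> by (auto simp: p_def)
        then show ?thesis using False greater G_arc by auto
      qed
    qed
  qed
  have or: "orientation_of (oriented_cycle l w) (cycle_graph l)"
    using l(2) by (rule orientation_of_oriented_cycle)
  \<comment> \<open>By pattern, the first and the last step use the same edge at the root in
    opposite directions, which gives the required turn at 0.\<close>
  have "w 0 \<longleftrightarrow> 0 \<in> Y" using n lw_0 by (simp add: w_def)
  moreover have "w (l - 1) \<longleftrightarrow> 0 \<notin> Y" using n l(3) lw_0 by (auto simp: w_def) (auto simp: l_def)
  ultimately have "acyclic_digraph (oriented_cycle l w)"
    using l(2) by (intro acyclic_oriented_cycle) auto
  moreover have "free_of F (oriented_cycle l w)"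
  proof -
    have "\<not> embeds A (oriented_cycle l w)" if A: "A \<in> F" for A
    proof
      assume emb: "embeds A (oriented_cycle l w)"
      have "finite (pverts A)"
        using F(1) A unfolding oriented_graph_def by (meson pair_digraph_def pair_fin_digraph.pair_finite_verts)
      then have "embeds A D"
        using F(2) A l(1) by (intro embeds_oriented_cycle_transfer[OF emb _ _ _ p_in p_inj p_arc]) auto
      then show False using D(2) A F(1) D_or by (simp add: free_of_iff_embeds)
    qed
    then show ?thesis using F(1) or by (simp add: free_of_iff_embeds orientation_of_def)
  qed
  ultimately show ?thesis
    using or expr pair_graph_cycle_graph[OF l(2)] unfolding l_def by blast
qed

theorem theorem16:
  fixes C :: "nat set" and P :: "nat pair_pre_digraph set"
  assumes "\<forall>c\<in>C. 0 < c"
    and "P = no_hole_class C"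
    and "expressible_by_forbidden_acyclic_orientations P"
  shows "(finite C \<or>
          finite ({n. 0 < n} - C) \<or>
          (\<exists>M>0. at_least_part C M = {n. odd n \<and> M \<le> n})) \<and>
         (finite ({n. 0 < n} - C) \<longleftrightarrow> finite (cyc P)) \<and>
         ((\<exists>M>0. at_least_part C M = {n. odd n \<and> M \<le> n}) \<longleftrightarrow>
          (\<exists>M>0. at_least_part (cyc P) M = {n. even n \<and> M \<le> n}))"
proof (intro conjI)
  have cyc: "k \<in> cyc P \<longleftrightarrow> k = 3 \<or> 4 \<le> k \<and> k \<notin> C" for k
    unfolding assms(2) by (rule mem_cyc_no_hole_class_iff)
  obtain F where F: "finite F" "\<forall>A\<in>F. oriented_graph A"
    and expr: "\<forall>G. pair_graph G \<longrightarrow>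
      (G \<in> no_hole_class C \<longleftrightarrow> (\<exists>D. orientation_of D G \<and> acyclic_digraph D \<and> free_of F D))"
    using assms(3) unfolding expressible_by_forbidden_acyclic_orientations_def assms(2) by blast
  have "finite ((\<lambda>A. card (pverts A)) ` F)" using F(1) by simp
  then obtain N where N: "\<forall>A\<in>F. card (pverts A) \<le> N"
    unfolding finite_nat_set_iff_bounded_le by blast
  \<comment> \<open>\<open>N + 4\<close> secures both \<open>4 \<le> k\<close> and
    \<open>N + 2 \<le> k\<close>.\<close>
  have reach: "2 * n + m * k \<notin> C" if "N + 4 \<le> k" "k \<notin> C" "N < n" "0 < m" for k n m
  proof -
    have "cycle_graph (2 * n + m * k) \<in> no_hole_class C"
      using that by (intro cycle_graph_closed_under_lasso_walk[OF F(2) N expr]) auto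
    moreover have "k \<le> m * k" using that by simp
    then have "4 \<le> 2 * n + m * k" using that(1) by linarith
    ultimately have "2 * n + m * k \<in> cyc P" "2 * n + m * k \<noteq> 3"
      unfolding cyc_def assms(2) by auto
    then show ?thesis using cyc by blast
  qed
  show "finite C \<or> finite ({n. 0 < n} - C) \<or> (\<exists>M>0. at_least_part C M = {n. odd n \<and> M \<le> n})"
  \<comment> \<open>A large odd length missing from \<open>C\<close> excludes all large numbers: two
    turns give the even ones, one turn the odd ones. Otherwise all large odd numbers lie in
    \<open>C\<close>, and a large missing length is even.\<close>
  proof (cases "\<exists>k. odd k \<and> N + 4 \<le> k \<and> k \<notin> C")
    case True
    then obtain k where k: "odd k" "N + 4 \<le> k" "k \<notin> C" by blast
    have "x \<notin> C" if x: "2 * N + 2 + 2 * k \<le> x" for x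
    proof (cases "even x")
      case True
      then have "x = 2 * ((x - 2 * k) div 2) + 2 * k" using x by auto
      moreover have "N < (x - 2 * k) div 2" using x by auto
      ultimately show ?thesis using reach[OF k(2,3), of _ 2] by (metis zero_less_numeral)
    next
      case False
      then have "x = 2 * ((x - k) div 2) + 1 * k" using x k(1) by auto
      moreover have "N < (x - k) div 2" using x by auto
      ultimately show ?thesis using reach[OF k(2,3), of _ 1] by (metis zero_less_one)
    qed
    then have "C \<subseteq> {..<2 * N + 2 + 2 * k}" by (auto simp: not_le[symmetric])
    then show ?thesis using finite_subset by blast
  next
    case odds: False
    show ?thesis
    proof (cases "finite ({n. 0 < n} - C)")
      case False
      then obtain k where k: "N + 4 \<le> k" "k \<notin> C"
        unfolding infinite_nat_iff_unbounded_le by blast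
      with odds have "even k" by blast
      \<comment> \<open>From \<open>M\<close> on, \<open>(x - k) div 2\<close> exceeds
        \<open>N\<close>, as \<open>reach\<close> demands.\<close>
      define M where "M = 2 * N + 2 + k"
      have "x \<in> C \<longleftrightarrow> odd x" if x: "M \<le> x" for x
      proof (cases "even x")
        case True
        then have "x = 2 * ((x - k) div 2) + 1 * k" using x \<open>even k\<close> by (auto simp: M_def)
        moreover have "N < (x - k) div 2" using x by (auto simp: M_def)
        ultimately show ?thesis using reach[OF k, of _ 1] True by (metis zero_less_one)
      next
        case False
        moreover have "N + 4 \<le> x" using x k by (simp add: M_def)
        ultimately show ?thesis using odds by blast
      qed
      then have "at_least_part C M = {n. odd n \<and> M \<le> n}" by (auto simp: at_least_part_def)
      moreover have "0 < M" by (simp add: M_def)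
      ultimately show ?thesis by blast
    qed simp
  qed
  show "finite ({n. 0 < n} - C) \<longleftrightarrow> finite (cyc P)"
  proof
    assume "finite ({n. 0 < n} - C)"
    moreover have "cyc P \<subseteq> {3} \<union> ({n. 0 < n} - C)" using cyc by auto
    ultimately show "finite (cyc P)" by (meson finite.simps finite_UnI finite_subset)
  next
    assume "finite (cyc P)"
    \<comment> \<open>The complement of \<open>C\<close> and \<open>cyc P\<close> agree from 4 on,
      so they can differ only in small numbers.\<close>
    moreover have "{n. 0 < n} - C \<subseteq> {..3} \<union> cyc P"
    proof
      fix x assume "x \<in> {n. 0 < n} - C"
      then show "x \<in> {..3} \<union> cyc P" using cyc[of x] by (cases "4 \<le> x") auto
    qed
    ultimately show "finite ({n. 0 < n} - C)" by (meson finite_UnI finite_atMost finite_subset)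
  qed
  show "(\<exists>M>0. at_least_part C M = {n. odd n \<and> M \<le> n}) \<longleftrightarrow>
      (\<exists>M>0. at_least_part (cyc P) M = {n. even n \<and> M \<le> n})"
  proof
    assume "\<exists>M>0. at_least_part C M = {n. odd n \<and> M \<le> n}"
    then obtain M where "at_least_part C M = {n. odd n \<and> M \<le> n}" by blast
    \<comment> \<open>Raising the threshold by 4 passes the lengths below 4, where membership in
      \<open>cyc P\<close> is not governed by \<open>C\<close>.\<close>
    then have "x \<in> cyc P \<longleftrightarrow> even x" if "M + 4 \<le> x" for x
      using that cyc[of x] unfolding at_least_part_def set_eq_iff by force
    then have "at_least_part (cyc P) (M + 4) = {n. even n \<and> M + 4 \<le> n}"
      unfolding at_least_part_def by blast
    then show "\<exists>M>0. at_least_part (cyc P) M = {n. even n \<and> M \<le> n}" by (metis add_gr_0 zero_less_numeral)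
  next
    assume "\<exists>M>0. at_least_part (cyc P) M = {n. even n \<and> M \<le> n}"
    then obtain M where "at_least_part (cyc P) M = {n. even n \<and> M \<le> n}" by blast
    then have "x \<in> C \<longleftrightarrow> odd x" if "M + 4 \<le> x" for x
      using that cyc[of x] unfolding at_least_part_def set_eq_iff by force
    then have "at_least_part C (M + 4) = {n. odd n \<and> M + 4 \<le> n}"
      unfolding at_least_part_def by blast
    then show "\<exists>M>0. at_least_part C M = {n. odd n \<and> M \<le> n}" by (metis add_gr_0 zero_less_numeral)
  qed
qed

end
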